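(* Let $n\ge1$, $L\ge1$. In the skin-deep de Bruijn process on $G^{n,L}$, for $a,b\in\Sigma$ with $a\ne b$ and $1\le i<j\le L$, $$\langle\eta^{a,i}\eta^{a,j}\rangle=\frac1{n^2}+\frac{n-1}{n^2}\left(\frac{1-x}{1+(n-1)x}\right)^{j-i},$$ $$\langle\eta^{a,i}\eta^{b,j}\rangle=\frac1{n^2}-\frac{1}{n^2}\left(\frac{1-x}{1+(n-1)x}\right)^{j-i}.$$
   Context: Let $\Sigma=\{1,\dots,n\}$ and let $\Sigma^L$ be the set of words of length $L$ over $\Sigma$. For a word $u=u_1\cdots u_L$ put $h(u)=u_1\cdots u_{L-1}$ and $t(u)=u_2\cdots u_L$ (the empty word if $L=1$). The de Bruijn graph $G^{n,L}$ has vertex set $\Sigma^L$ and an edge from $u$ to $v$ if and only if $h(v)=t(u)$. Skin-deep de Bruijn process: let $x$ be a formal variable (all probabilities are rational functions of $x$). For a nonempty word $v$ put $\beta_x(v)=x$ if the last block of $v$ (the maximal suffix consisting of repetitions of a single letter) has length $1$, and $\beta_x(v)=1$ if the last block has length greater than $1$. The process is the continuous-time Markov chain on $\Sigma^L$ in which the transition $u\to v$ along an edge of $G^{n,L}$ has rate $\beta_x(v)$. Its stationary distribution is the unique vector $(\bar\mu_x(u))_{u\in\Sigma^L}$ with $\sum_{u\in\Sigma^L}\bar\mu_x(u)=1$ and, for each $v\in\Sigma^L$, $$\sum_{u\in\Sigma^L:\,t(u)=h(v)}\beta_x(v)\,\bar\mu_x(u)=\Big(\sum_{a\in\Sigma}\beta_x(t(v).a)\Big)\bar\mu_x(v).$$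 $\eta^{a,i}$ is the random variable equal to $1$ if the $i$-th letter of the word is $a$ and $0$ otherwise, and $\langle\cdot\rangle$ denotes expectation with respect to $\bar\mu_x$. *)

theory Defs
  imports Complex_Main "HOL-Computational_Algebra.Polynomial"
    "HOL-Computational_Algebra.Fraction_Field"
begin

type_synonym ratfun = "rat poly fract"

definition formal_x :: ratfun where
  "formal_x = Fract [:0, 1:] 1"

definition words :: "nat \<Rightarrow> nat \<Rightarrow> nat list set" where
  "words n L = {u. length u = L \<and> set u \<subseteq> {1..n}}"

text \<open>The maps \<open>h\<close> and \<open>t\<close> on nonempty words are \<^const>\<open>butlast\<close> and \<^const>\<open>tl\<close>.\<close>

definition de_bruijn_edges :: "nat \<Rightarrow> nat \<Rightarrow> (nat list \<times> nat list) set" where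
  "de_bruijn_edges n L =
     {(u, v). u \<in> words n L \<and> v \<in> words n L \<and> butlast v = tl u}"

definition last_block :: "'b list \<Rightarrow> 'b list" where
  "last_block v = takeWhile (\<lambda>c. c = last v) (rev v)"

definition skin_rate :: "'a::field \<Rightarrow> nat list \<Rightarrow> 'a" where
  "skin_rate x v = (if length (last_block v) = 1 then x else 1)"

text \<open>Vectors indexed by \<open>words n L\<close> are functions on all lists that vanish outside
  \<open>words n L\<close>; without this normalisation a stationary vector could not be unique.\<close>

definition is_stationary :: "nat \<Rightarrow> nat \<Rightarrow> 'a::field \<Rightarrow> (nat list \<Rightarrow> 'a) \<Rightarrow> bool" where
  "is_stationary n L x \<mu> \<longleftrightarrow>
     (\<forall>u. u \<notin> words n L \<longrightarrow> \<mu> u = 0) \<and>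
     (\<Sum>u\<in>words n L. \<mu> u) = 1 \<and>
     (\<forall>v\<in>words n L.
        (\<Sum>u | (u, v) \<in> de_bruijn_edges n L. skin_rate x v * \<mu> u) =
        (\<Sum>a\<in>{1..n}. skin_rate x (tl v @ [a])) * \<mu> v)"

definition stationary :: "nat \<Rightarrow> nat \<Rightarrow> 'a::field \<Rightarrow> nat list \<Rightarrow> 'a" where
  "stationary n L x = (THE \<mu>. is_stationary n L x \<mu>)"

definition expect :: "nat \<Rightarrow> nat \<Rightarrow> 'a::field \<Rightarrow> (nat list \<Rightarrow> 'a) \<Rightarrow> 'a" where
  "expect n L x f = (\<Sum>u\<in>words n L. f u * stationary n L x u)"

text \<open>Positions in a word are counted from 1.\<close>

definition eta :: "nat \<Rightarrow> nat \<Rightarrow> nat list \<Rightarrow> 'a::field" where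
  "eta a i u = (if u ! (i - 1) = a then 1 else 0)"

end

(* For L \<ge> 2 the balance equations say that the last letter is obtained from the previous ones by
   a step of the chain on the alphabet that moves from a to b with probability 1/D if a = b
   and x/D otherwise, where D = 1 + (n-1)x.  This kernel is doubly stochastic, so the path measure
   started from the uniform distribution is stationary.  Conversely, in a stationary vector
   the law of the last letter is invariant under the kernel, hence uniform, and repeated use of
   the balance equation recovers the path measure.  The kernel acts on vectors of sum 0 as
   multiplication by (1-x)/D, which gives the correlations. *)

theory Submission
  imports Defs
begin

section \<open>Words\<close>

lemma words_0: "words n 0 = {[]}"
  by (auto simp: words_def)

lemma words_Cons: "words n (Suc L) = (\<lambda>(c, w). c # w) ` ({1..n} \<times> words n L)"
proof (rule set_eqI)
  show "u \<in> words n (Suc L) \<longleftrightarrow> u \<in> (\<lambda>(c, w). c # w) ` ({1..n} \<times> words n L)" for u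
    by (cases u) (auto simp: words_def image_iff)
qed

lemma words_snoc: "words n (Suc L) = (\<lambda>(w, c). w @ [c]) ` (words n L \<times> {1..n})"
proof (rule set_eqI)
  show "u \<in> words n (Suc L) \<longleftrightarrow> u \<in> (\<lambda>(w, c). w @ [c]) ` (words n L \<times> {1..n})" for u
    by (cases u rule: rev_cases) (auto simp: words_def image_iff)
qed

lemma sum_words_Cons:
  "(\<Sum>u\<in>words n (Suc L). f u) = (\<Sum>c\<in>{1..n}. \<Sum>w\<in>words n L. f (c # w))"
proof -
  have "(\<Sum>u\<in>words n (Suc L). f u) = (\<Sum>(c, w)\<in>{1..n} \<times> words n L. f (c # w))"
    unfolding words_Cons by (subst sum.reindex) (auto simp: inj_on_def split_def)
  then show ?thesis by (simp add: sum.cartesian_product)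
qed

lemma sum_words_snoc:
  "(\<Sum>u\<in>words n (Suc L). f u) = (\<Sum>w\<in>words n L. \<Sum>c\<in>{1..n}. f (w @ [c]))"
proof -
  have "(\<Sum>u\<in>words n (Suc L). f u) = (\<Sum>(w, c)\<in>words n L \<times> {1..n}. f (w @ [c]))"
    unfolding words_snoc by (subst sum.reindex) (auto simp: inj_on_def split_def)
  then show ?thesis by (simp add: sum.cartesian_product)
qed

lemma last_word: "w \<in> words n (Suc L) \<Longrightarrow> last w \<in> {1..n}"
  by (auto simp: words_snoc)

lemma hd_word: "w \<in> words n (Suc L) \<Longrightarrow> hd w \<in> {1..n}"
  by (auto simp: words_Cons)

lemma word_nonempty: "w \<in> words n (Suc L) \<Longrightarrow> w \<noteq> []"
  by (auto simp: words_def)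

text \<open>The last block of \<open>w @ [b]\<close> is longer than one letter exactly when
  \<open>b\<close> repeats \<open>last w\<close>, so only the last two letters matter.\<close>

lemma skin_rate_snoc:
  "w \<noteq> [] \<Longrightarrow> skin_rate x (w @ [b]) = (if last w = b then 1 else x)"
  by (cases w rule: rev_cases) (auto simp: skin_rate_def last_block_def)

lemma sum_edges_into:
  assumes "w \<in> words n L" "b \<in> {1..n}"
  shows "(\<Sum>u | (u, w @ [b]) \<in> de_bruijn_edges n (Suc L). f u) = (\<Sum>c\<in>{1..n}. f (c # w))"
proof -
  have "{u. (u, w @ [b]) \<in> de_bruijn_edges n (Suc L)} = (\<lambda>c. c # w) ` {1..n}"
  proof -
    have "w @ [b] \<in> words n (Suc L)"
      using assms by (auto simp: words_def)
    then have "{u. (u, w @ [b]) \<in> de_bruijn_edges n (Suc L)} = {u \<in> words n (Suc L). tl u = w}"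
      by (auto simp: de_bruijn_edges_def)
    also have "\<dots> = (\<lambda>c. c # w) ` {1..n}"
      using assms(1) by (auto simp: words_Cons)
    finally show ?thesis .
  qed
  then show ?thesis by (simp add: sum.reindex inj_on_def)
qed

section \<open>The chain on the alphabet\<close>

text \<open>For \<open>x = 0\<close> the kernel below would be the identity and every law on the
  alphabet invariant; uniqueness rests on \<open>x_nz\<close>.\<close>

locale skin_deep =
  fixes n :: nat and x D :: "'a::field"
  assumes n_nz: "of_nat n \<noteq> (0 :: 'a)" and x_nz: "x \<noteq> 0"
    and D_nz: "D \<noteq> 0" and D_eq: "D = 1 + (of_nat n - 1) * x"
begin

definition kernel :: "nat \<Rightarrow> nat \<Rightarrow> 'a" where
  "kernel a b = (if a = b then 1 else x) / D"

lemma kernel_sym: "kernel a b = kernel b a"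
  by (simp add: kernel_def)

lemma kernel_alt: "kernel a b = x / D + (1 - x) / D * of_bool (a = b)"
  by (simp add: kernel_def add_divide_distrib [symmetric])

text \<open>The kernel is x/D times the all-ones matrix plus (1-x)/D times the identity; the first
  part sees only the total of \<open>f\<close>.\<close>

lemma sum_kernel_times:
  assumes "b \<in> {1..n}"
  shows "(\<Sum>c\<in>{1..n}. f c * kernel c b) = (x * (\<Sum>c\<in>{1..n}. f c) + (1 - x) * f b) / D"
proof -
  have "(\<Sum>c\<in>{1..n}. f c * kernel c b) =
      (\<Sum>c\<in>{1..n}. x / D * f c + (if c = b then (1 - x) / D * f c else 0))"
    by (intro sum.cong) (auto simp: kernel_alt algebra_simps)
  also have "\<dots> = x / D * (\<Sum>c\<in>{1..n}. f c) + (1 - x) / D * f b"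
    using assms by (simp add: sum.distrib sum_distrib_left)
  finally show ?thesis by (simp add: add_divide_distrib)
qed

lemma sum_kernel:
  assumes "b \<in> {1..n}"
  shows "(\<Sum>c\<in>{1..n}. kernel c b) = 1"
  using sum_kernel_times [OF assms, of "\<lambda>_. 1"] D_nz by (simp add: D_eq algebra_simps)

lemma sum_kernel':
  assumes "b \<in> {1..n}"
  shows "(\<Sum>c\<in>{1..n}. kernel b c) = 1"
  using sum_kernel [OF assms] by (simp add: kernel_sym)

text \<open>The initial factor 1/n is left out, so that adding a letter at either end of a nonempty
  word multiplies by one kernel entry.\<close>

fun path_weight :: "nat list \<Rightarrow> 'a" where
  "path_weight [] = 1"
| "path_weight [a] = 1"
| "path_weight (a # b # w) = kernel a b * path_weight (b # w)"

lemma path_weight_Cons: "w \<noteq> [] \<Longrightarrow> path_weight (c # w) = kernel c (hd w) * path_weight w"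
  by (cases w) auto

lemma path_weight_snoc:
  "w \<noteq> [] \<Longrightarrow> path_weight (w @ [b]) = path_weight w * kernel (last w) b"
  by (induction w rule: path_weight.induct) auto

text \<open>Columns of the kernel sum to 1, so the first letter sums out. This shift invariance is
  what makes the path measure stationary.\<close>

lemma sum_path_weight_Cons:
  assumes "w \<in> words n (Suc L)"
  shows "(\<Sum>c\<in>{1..n}. path_weight (c # w)) = path_weight w"
  using sum_kernel [OF hd_word [OF assms]] word_nonempty [OF assms]
  by (simp add: path_weight_Cons sum_distrib_right [symmetric])

lemma sum_path_weight_snoc:
  assumes "w \<in> words n (Suc L)"
  shows "(\<Sum>c\<in>{1..n}. path_weight (w @ [c])) = path_weight w"
  using sum_kernel' [OF last_word [OF assms]] word_nonempty [OF assms]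
  by (simp add: path_weight_snoc sum_distrib_left [symmetric])

lemma sum_path_weight: "(\<Sum>w\<in>words n (Suc L). path_weight w) = of_nat n"
proof (induction L)
  case 0
  show ?case by (simp add: sum_words_Cons words_0)
next
  case (Suc L)
  then show ?case
    by (subst sum_words_snoc) (simp add: sum_path_weight_snoc del: One_nat_def)
qed

section \<open>The stationary distribution\<close>

text \<open>The value 0 off \<open>words n L\<close> matches the normalisation in
  \<open>is_stationary\<close>, so that uniqueness holds as equality of functions.\<close>

definition path_measure :: "nat \<Rightarrow> nat list \<Rightarrow> 'a" where
  "path_measure L u = (if u \<in> words n L then path_weight u / of_nat n else 0)"

text \<open>One continuation repeats the last letter at rate 1 and n-1 change it at rate x, so the
  exit rate is the same for all words.\<close>

lemma sum_skin_rate: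
  assumes "w \<noteq> []" "last w \<in> {1..n}"
  shows "(\<Sum>a\<in>{1..n}. skin_rate x (w @ [a])) = D"
proof -
  have "(\<Sum>a\<in>{1..n}. skin_rate x (w @ [a])) = D * (\<Sum>a\<in>{1..n}. kernel (last w) a)"
    using D_nz assms(1) by (simp add: sum_distrib_left skin_rate_snoc kernel_def)
  then show ?thesis using sum_kernel' [OF assms(2)] by simp
qed

text \<open>The exit rate is the constant \<open>D\<close>, and dividing the balance equation by it
  turns rates into kernel entries. Length at least 2 gives the final letter a predecessor.\<close>

lemma is_stationary_iff:
  "is_stationary n (Suc (Suc L)) x \<mu> \<longleftrightarrow>
     (\<forall>u. u \<notin> words n (Suc (Suc L)) \<longrightarrow> \<mu> u = 0) \<and>
     (\<Sum>u\<in>words n (Suc (Suc L)). \<mu> u) = 1 \<and>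
     (\<forall>w\<in>words n (Suc L). \<forall>b\<in>{1..n}.
        \<mu> (w @ [b]) = kernel (last w) b * (\<Sum>c\<in>{1..n}. \<mu> (c # w)))"
proof -
  have "(\<Sum>u | (u, w @ [b]) \<in> de_bruijn_edges n (Suc (Suc L)). skin_rate x (w @ [b]) * \<mu> u) =
        (\<Sum>a\<in>{1..n}. skin_rate x (tl (w @ [b]) @ [a])) * \<mu> (w @ [b]) \<longleftrightarrow>
      \<mu> (w @ [b]) = kernel (last w) b * (\<Sum>c\<in>{1..n}. \<mu> (c # w))"
    if "w \<in> words n (Suc L)" "b \<in> {1..n}" for w b
  proof -
    have w: "w \<noteq> []" using word_nonempty that(1) .
    have "(\<Sum>a\<in>{1..n}. skin_rate x ((tl w @ [b]) @ [a])) = D"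
      by (rule sum_skin_rate) (use that in auto)
    then have "(\<Sum>a\<in>{1..n}. skin_rate x (tl (w @ [b]) @ [a])) = D"
      using w by simp
    moreover have "(\<Sum>u | (u, w @ [b]) \<in> de_bruijn_edges n (Suc (Suc L)).
        skin_rate x (w @ [b]) * \<mu> u) = D * (kernel (last w) b * (\<Sum>c\<in>{1..n}. \<mu> (c # w)))"
      using w D_nz
      by (subst sum_edges_into [OF that])
        (simp add: skin_rate_snoc kernel_def sum_distrib_left)
    ultimately show ?thesis using D_nz by (simp only: mult_left_cancel) auto
  qed
  then show ?thesis
    unfolding is_stationary_def words_snoc [of n "Suc L"] by auto
qed

lemma path_measure_stationary:
  "is_stationary n (Suc (Suc L)) x (path_measure (Suc (Suc L)))"
  unfolding is_stationary_iff
proof (intro conjI allI ballI impI)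
  show "path_measure (Suc (Suc L)) u = 0" if "u \<notin> words n (Suc (Suc L))" for u
    using that by (simp add: path_measure_def)
  show "(\<Sum>u\<in>words n (Suc (Suc L)). path_measure (Suc (Suc L)) u) = 1"
    using n_nz by (simp add: path_measure_def sum_divide_distrib [symmetric] sum_path_weight)
  fix w b assume w: "w \<in> words n (Suc L)" and b: "b \<in> {1..n}"
  have "w @ [b] \<in> words n (Suc (Suc L))"
    using w b by (auto simp: words_snoc [of n "Suc L"])
  moreover have "c # w \<in> words n (Suc (Suc L))" if "c \<in> {1..n}" for c
    using w that by (auto simp: words_Cons [of n "Suc L"])
  then have "(\<Sum>c\<in>{1..n}. path_measure (Suc (Suc L)) (c # w)) = path_weight w / of_nat n"
    by (simp add: path_measure_def sum_divide_distrib [symmetric] sum_path_weight_Cons [OF w]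
        del: One_nat_def)
  ultimately show "path_measure (Suc (Suc L)) (w @ [b]) =
      kernel (last w) b * (\<Sum>c\<in>{1..n}. path_measure (Suc (Suc L)) (c # w))"
    using word_nonempty [OF w] by (simp add: path_measure_def path_weight_snoc)
qed

text \<open>Invariance under the kernel and total mass 1 leave one linear equation for each single
  entry of the law \<open>q\<close>.\<close>

lemma stationary_last_letter:
  assumes "is_stationary n (Suc (Suc L)) x \<mu>" and b: "b \<in> {1..n}"
  shows "(\<Sum>w\<in>words n (Suc L). \<mu> (w @ [b])) = 1 / of_nat n"
proof -
  define q where "q b = (\<Sum>w\<in>words n (Suc L). \<mu> (w @ [b]))" for b
  have total: "(\<Sum>u\<in>words n (Suc (Suc L)). \<mu> u) = 1"
    and bal: "\<And>w b. w \<in> words n (Suc L) \<Longrightarrow> b \<in> {1..n} \<Longrightarrow>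
      \<mu> (w @ [b]) = kernel (last w) b * (\<Sum>c\<in>{1..n}. \<mu> (c # w))"
    using assms(1) unfolding is_stationary_iff by auto
  have sum_q: "(\<Sum>c\<in>{1..n}. q c) = 1"
    unfolding q_def by (subst sum.swap) (use total in \<open>simp add: sum_words_snoc\<close>)
  \<comment> \<open>Writing \<open>last (c # w)\<close> for \<open>last w\<close> makes the summand
    a function of the whole word \<open>c # w\<close>; the words are then regrouped by their last
    letter.\<close>
  have "q b = (\<Sum>w\<in>words n (Suc L). \<Sum>c\<in>{1..n}. \<mu> (c # w) * kernel (last (c # w)) b)"
    unfolding q_def
    by (intro sum.cong refl)
      (use word_nonempty in \<open>simp add: bal [OF _ b] sum_distrib_left mult.commute\<close>)
  also have "\<dots> = (\<Sum>u\<in>words n (Suc (Suc L)). \<mu> u * kernel (last u) b)"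
    by (subst sum.swap) (simp only: sum_words_Cons [of _ _ "Suc L"])
  also have "\<dots> = (\<Sum>c\<in>{1..n}. q c * kernel c b)"
    unfolding sum_words_snoc [of _ _ "Suc L"] q_def sum_distrib_right
    by (subst sum.swap) simp
  also have "\<dots> = (x + (1 - x) * q b) / D"
    unfolding sum_kernel_times [OF b] sum_q by simp
  finally have "q b * D = x + (1 - x) * q b"
    using D_nz by (simp add: eq_divide_eq)
  \<comment> \<open>Inserting \<open>D_eq\<close> cancels the terms in \<open>q b\<close> that are
    free of x.\<close>
  then have "x * (of_nat n * q b) = x * 1"
    by (simp add: D_eq algebra_simps)
  then have "of_nat n * q b = 1"
    using x_nz by simp
  then show ?thesis
    using n_nz unfolding q_def [symmetric] by (simp add: field_simps)
qed

text \<open>Balance trades the final letter of the suffix for a kernel factor and one more summed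
  letter in front. The prefix grows as the suffix shrinks, hence \<open>m\<close> is arbitrary,
  until the law of the last letter settles the base case.\<close>

lemma stationary_suffix:
  assumes st: "is_stationary n (Suc (Suc L)) x \<mu>"
    and "w \<noteq> []" "set w \<subseteq> {1..n}" "m + length w = Suc (Suc L)"
  shows "(\<Sum>p\<in>words n m. \<mu> (p @ w)) = path_weight w / of_nat n"
  using assms(2-4)
proof (induction w arbitrary: m rule: rev_nonempty_induct)
  case (single b)
  then show ?case using stationary_last_letter [OF st] by simp
next
  case (snoc b w)
  have "(\<Sum>p\<in>words n m. \<mu> (p @ w @ [b])) =
      (\<Sum>p\<in>words n m. kernel (last w) b * (\<Sum>c\<in>{1..n}. \<mu> (c # p @ w)))"
  proof (intro sum.cong refl)
    fix p assume "p \<in> words n m"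
    then have "p @ w \<in> words n (Suc L)"
      using snoc.prems by (auto simp: words_def)
    then have "\<mu> ((p @ w) @ [b]) =
        kernel (last (p @ w)) b * (\<Sum>c\<in>{1..n}. \<mu> (c # p @ w))"
      using st snoc.prems unfolding is_stationary_iff by (simp del: append_assoc)
    then show "\<mu> (p @ w @ [b]) = kernel (last w) b * (\<Sum>c\<in>{1..n}. \<mu> (c # p @ w))"
      using snoc.hyps by simp
  qed
  also have "\<dots> = kernel (last w) b * (\<Sum>p\<in>words n (Suc m). \<mu> (p @ w))"
    by (subst sum_words_Cons, subst sum.swap) (simp add: sum_distrib_left)
  also have "\<dots> = kernel (last w) b * (path_weight w / of_nat n)"
    using snoc.IH [of "Suc m"] snoc.prems by simp
  finally show ?case
    using snoc.hyps by (simp add: path_weight_snoc)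
qed

lemma stationary_eq: "stationary n (Suc (Suc L)) x = path_measure (Suc (Suc L))"
  unfolding stationary_def
proof (rule the_equality, rule path_measure_stationary)
  fix \<mu> assume st: "is_stationary n (Suc (Suc L)) x \<mu>"
  show "\<mu> = path_measure (Suc (Suc L))"
  proof
    fix u
    show "\<mu> u = path_measure (Suc (Suc L)) u"
    proof (cases "u \<in> words n (Suc (Suc L))")
      case True
      \<comment> \<open>With an empty prefix the suffix is the whole word.\<close>
      then have "(\<Sum>p\<in>words n 0. \<mu> (p @ u)) = path_weight u / of_nat n"
        by (intro stationary_suffix [OF st]) (auto simp: words_def)
      with True show ?thesis by (simp add: words_0 path_measure_def)
    next
      case False
      then show ?thesis using st by (simp add: is_stationary_iff path_measure_def)
    qed
  qed
qed

section \<open>Correlations\<close>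

text \<open>The eigenvalue of the kernel on vectors of sum 0.\<close>

definition ratio :: 'a where "ratio = (1 - x) / D"

text \<open>A form of 1 - ratio = n x / D, which holds since D - (1 - x) = n x.\<close>

lemma x_div_D: "x / D = 1 / of_nat n - 1 / of_nat n * ratio"
  using D_nz n_nz by (simp add: ratio_def field_simps) (simp add: D_eq algebra_simps)

lemma kernel_ratio: "kernel a b = 1 / of_nat n + (of_bool (a = b) - 1 / of_nat n) * ratio"
  unfolding kernel_alt ratio_def [symmetric] x_div_D by (simp add: algebra_simps)

lemma path_weight_last:
  assumes "b \<in> {1..n}"
  shows "(\<Sum>w\<in>words n L. path_weight (w @ [b])) = 1"
  using assms
proof (induction L arbitrary: b)
  case 0
  then show ?case by (simp add: words_0)
next
  case (Suc L)
  have "(\<Sum>w\<in>words n (Suc L). path_weight (w @ [b])) =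
      (\<Sum>c\<in>{1..n}. (\<Sum>w\<in>words n L. path_weight (w @ [c])) * kernel c b)"
    unfolding sum_distrib_right
    by (subst sum.swap) (simp add: sum_words_snoc path_weight_snoc del: append_assoc)
  then show ?case using Suc sum_kernel by simp
qed

text \<open>In effect an entry of the (d+1)-st power of the kernel: the letters before position
  \<open>i\<close>, counted from 0, sum out, and \<open>b\<close> comes d+1 steps after it.\<close>

lemma path_weight_pair:
  assumes "a \<in> {1..n}" "b \<in> {1..n}"
  shows "(\<Sum>w\<in>words n (Suc (i + d)). of_bool (w ! i = a) * path_weight (w @ [b])) =
    1 / of_nat n + (of_bool (a = b) - 1 / of_nat n) * ratio ^ Suc d"
  using assms
proof (induction d arbitrary: b)
  case 0
  \<comment> \<open>The marked letter is the last one of \<open>w\<close>, so only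
    \<open>c = a\<close> survives, with one kernel step to \<open>b\<close>.\<close>
  have "(\<Sum>w\<in>words n (Suc i). of_bool (w ! i = a) * path_weight (w @ [b])) =
      (\<Sum>w\<in>words n i. \<Sum>c\<in>{1..n}. if c = a then path_weight (w @ [a]) * kernel a b else 0)"
    unfolding sum_words_snoc
    by (intro sum.cong refl)
      (auto simp: words_def nth_append path_weight_snoc simp del: append_assoc)
  also have "\<dots> = kernel a b"
    using 0 path_weight_last [OF 0(1)] by (simp add: sum_distrib_right [symmetric])
  finally show ?case by (simp add: kernel_ratio)
next
  case (Suc d)
  define f where "f c = (\<Sum>w\<in>words n (Suc (i + d)). of_bool (w ! i = a) * path_weight (w @ [c]))"
    for c
  have f: "f c = 1 / of_nat n + (of_bool (a = c) - 1 / of_nat n) * ratio ^ Suc d"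
    if "c \<in> {1..n}" for c
    unfolding f_def using Suc that by blast
  have "(\<Sum>c\<in>{1..n}. of_bool (a = c) :: 'a) = 1"
    using Suc.prems by (simp add: of_bool_def)
  \<comment> \<open>The deviations of \<open>f\<close> from 1/n sum to 0.\<close>
  then have sum_f: "(\<Sum>c\<in>{1..n}. f c) = 1"
    using n_nz
    by (simp add: f sum.distrib sum_subtractf sum_distrib_right [symmetric] del: power_Suc)
  have "(\<Sum>w\<in>words n (Suc (i + Suc d)). of_bool (w ! i = a) * path_weight (w @ [b])) =
      (\<Sum>c\<in>{1..n}. f c * kernel c b)"
    unfolding f_def sum_distrib_right
    by (subst sum.swap, simp only: add_Suc_right, subst sum_words_snoc)
      (intro sum.cong refl,
       auto simp: words_def nth_append path_weight_snoc simp del: append_assoc)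
  \<comment> \<open>By \<open>x_div_D\<close>, 1/n is fixed under y -> x/D + ratio * y, so the
    deviation of \<open>f b\<close> from 1/n gains one factor \<open>ratio\<close>.\<close>
  also have "\<dots> = x / D + ratio * f b"
    unfolding sum_kernel_times [OF Suc.prems(2)] sum_f by (simp add: add_divide_distrib ratio_def)
  finally show ?case
    by (simp add: f [OF Suc.prems(2)] x_div_D algebra_simps)
qed

text \<open>The \<open>m\<close> letters after the second marked position sum out one by one, since
  rows of the kernel sum to 1.\<close>

lemma path_weight_correlation:
  assumes "a \<in> {1..n}" "b \<in> {1..n}"
  shows "(\<Sum>w\<in>words n (Suc (Suc (i + d)) + m).
      of_bool (w ! i = a) * of_bool (w ! Suc (i + d) = b) * path_weight w) =
    1 / of_nat n + (of_bool (a = b) - 1 / of_nat n) * ratio ^ Suc d"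
proof (induction m)
  case 0
  have "(\<Sum>w\<in>words n (Suc (Suc (i + d))).
      of_bool (w ! i = a) * of_bool (w ! Suc (i + d) = b) * path_weight w) =
    (\<Sum>w\<in>words n (Suc (i + d)). \<Sum>c\<in>{1..n}.
      if c = b then of_bool (w ! i = a) * path_weight (w @ [b]) else 0)"
    unfolding sum_words_snoc [of _ _ "Suc (i + d)"]
    by (intro sum.cong refl) (auto simp: words_def nth_append)
  then show ?case
    using path_weight_pair [OF assms] assms by simp
next
  case (Suc m)
  let ?K = "Suc (Suc (i + d)) + m"
  \<comment> \<open>Both marked positions lie below \<open>?K\<close>, so the indicators ignore the
    appended letter.\<close>
  have "(\<Sum>w\<in>words n (Suc ?K).
      of_bool (w ! i = a) * of_bool (w ! Suc (i + d) = b) * path_weight w) =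
    (\<Sum>w\<in>words n ?K. of_bool (w ! i = a) * of_bool (w ! Suc (i + d) = b) *
      (\<Sum>c\<in>{1..n}. path_weight (w @ [c])))"
    unfolding sum_words_snoc [of _ _ ?K] sum_distrib_left
    by (intro sum.cong refl) (auto simp: words_def nth_append)
  also have "\<dots> = (\<Sum>w\<in>words n ?K.
      of_bool (w ! i = a) * of_bool (w ! Suc (i + d) = b) * path_weight w)"
    by (intro sum.cong refl) (simp add: sum_path_weight_snoc del: One_nat_def)
  finally show ?case using Suc.IH by simp
qed

lemma expect_eta_eta:
  assumes "a \<in> {1..n}" "b \<in> {1..n}" "1 \<le> i" "i < j" "j \<le> L"
  shows "expect n L x (\<lambda>u. eta a i u * eta b j u) =
    1 / of_nat n ^ 2 + (of_nat n * of_bool (a = b) - 1) / of_nat n ^ 2 * ratio ^ (j - i)"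
proof -
  \<comment> \<open>\<open>k\<close> is the first position counted from 0, \<open>d\<close> the
    number of letters strictly between the two positions, \<open>m\<close> the number after the
    second. Thus L is at least 2 and \<open>stationary_eq\<close> applies.\<close>
  define k where "k = i - 1"
  define d where "d = j - i - 1"
  define m where "m = L - j"
  have ij: "i = Suc k" "j = Suc (Suc (k + d))" "L = Suc (Suc (k + d)) + m" "j - i = Suc d"
    using assms by (auto simp: k_def d_def m_def)
  have "expect n L x (\<lambda>u. eta a i u * eta b j u) = (\<Sum>w\<in>words n (Suc (Suc (k + d)) + m).
      of_bool (w ! k = a) * of_bool (w ! Suc (k + d) = b) * path_weight w) / of_nat n"
    unfolding expect_def ij(3) sum_divide_distrib
    by (intro sum.cong refl) (simp add: stationary_eq path_measure_def eta_def ij)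
  also have "\<dots> = (1 / of_nat n + (of_bool (a = b) - 1 / of_nat n) * ratio ^ Suc d) / of_nat n"
    using path_weight_correlation [OF assms(1,2)] by simp
  finally show ?thesis
    unfolding ij(4) using n_nz
    by (simp add: field_simps power2_eq_square)
qed

end

section \<open>The formal variable\<close>

lemma of_nat_ratfun: "(of_nat n :: ratfun) = Fract [:of_nat n:] 1"
  by (simp add: of_nat_fract of_nat_poly)

text \<open>Each nonvanishing is one of rational polynomials: the constant n in characteristic 0,
  the variable, and a polynomial with constant term 1.\<close>

lemma skin_deep_formal_x:
  assumes "n \<ge> 1"
  shows "skin_deep n formal_x (1 + (of_nat n - 1) * formal_x)"
proof
  show "of_nat n \<noteq> (0 :: ratfun)"
    using assms by (simp add: of_nat_ratfun Zero_fract_def eq_fract)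
  show "formal_x \<noteq> 0"
    by (simp add: formal_x_def Zero_fract_def eq_fract)
  show "1 + (of_nat n - 1) * formal_x \<noteq> 0"
    by (simp add: formal_x_def of_nat_ratfun Zero_fract_def One_fract_def eq_fract one_pCons)
qed simp

theorem proposition18:
  fixes n L i j a :: nat and x :: ratfun
  defines "x \<equiv> formal_x"
  assumes "n \<ge> 1" and "L \<ge> 1"
    and "a \<in> {1..n}"
    and "1 \<le> i" and "i < j" and "j \<le> L"
  shows "expect n L x (\<lambda>u. eta a i u * eta a j u) =
      1 / of_nat n ^ 2 + (of_nat n - 1) / of_nat n ^ 2 *
        ((1 - x) / (1 + (of_nat n - 1) * x)) ^ (j - i) \<and>
    (\<forall>b\<in>{1..n}. a \<noteq> b \<longrightarrow>
      expect n L x (\<lambda>u. eta a i u * eta b j u) =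
      1 / of_nat n ^ 2 - 1 / of_nat n ^ 2 *
        ((1 - x) / (1 + (of_nat n - 1) * x)) ^ (j - i))"
proof -
  interpret skin_deep n x "1 + (of_nat n - 1) * x"
    unfolding x_def by (rule skin_deep_formal_x) fact
  \<comment> \<open>The numerator is n-1 for \<open>b = a\<close> and -1 for \<open>b\<close>
    distinct from \<open>a\<close>, which yields both formulas.\<close>
  have "expect n L x (\<lambda>u. eta a i u * eta b j u) =
      1 / of_nat n ^ 2 + (of_nat n * of_bool (a = b) - 1) / of_nat n ^ 2 *
        ((1 - x) / (1 + (of_nat n - 1) * x)) ^ (j - i)" if "b \<in> {1..n}" for b
    using expect_eta_eta [OF \<open>a \<in> {1..n}\<close> that assms(5-7)] unfolding ratio_def .
  then show ?thesis
    using \<open>a \<in> {1..n}\<close> by (simp del: One_nat_def)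
qed

end
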